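(* Let $\mathbb K$ be a commutative unital ring, $\mathbb B$ an associative unital $\mathbb K$-algebra, $W$ a right $\mathbb B$-module and $\mathcal X=\mathrm{Gras}_{\mathbb B}(W)$ the set of all $\mathbb B$-submodules of $W$. Define $\Gamma:\mathcal X^5\to\mathcal X$ by $$\Gamma(x,a,y,b,z)=\{\omega\in W\mid \exists \xi\in x,\alpha\in a,\eta\in y,\beta\in b,\zeta\in z:\ \omega=\zeta+\alpha=\alpha+\eta+\beta=\xi+\beta\}.$$ Then $\Gamma$ extends the partially defined map $\Gamma_0:D(\Gamma_0)\to\mathcal X$ given in the context, and has the following properties: (1) It is symmetric under the Klein $4$-group: for all $x,a,y,b,z\in\mathcal X$, (a) $\Gamma(x,a,y,b,z)=\Gamma(z,b,y,a,x)$, and (b) $\Gamma(x,a,y,b,z)=\Gamma(a,x,y,z,b)$. (2) For any pair $(a,b)\in\mathcal X^2$, the product $(xyz):=\Gamma(x,a,y,b,z)$ on $\mathcal X^3$ satisfies the properties of a semitorsor, that is, for all $x,u,y,v,z\in\mathcal X$, $$\Gamma\bigl(x,a,u,b,\Gamma(y,a,v,b,z)\bigr)=\Gamma\bigl(x,a,\Gamma(v,a,y,b,u),b,z\bigr)=\Gamma\bigl(\Gamma(x,a,u,b,y),a,v,b,z\bigr).$$ Writing $\mathcal X_{ab}$ for $\mathcal X$ with this semitorsor structure, $\mathcal X_{ba}$ is the opposite semitorsor of $\mathcal X_{ab}$; in particular, $\mathcal X_{aa}$ is a commutative semitorsor for any $a$.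
   Context: For $x,a\in\mathcal X$ write $x\top a$ if $W=x\oplus a$; $C_{ab}=\{x\in\mathcal X: x\top a,\ x\top b\}$. If $x\top a$, $P_x^a:W\to W$ is the projector onto $x$ with kernel $a$. Linear maps act on submodules by direct image. The map $\Gamma_0$ is defined on $D(\Gamma_0)=D_L\cup D_R\cup D_M\subset\mathcal X^5$, where $D_L=\{(x,a,y,b,z): x\top a,\ y\top b\}$, $D_R=\{(x,a,y,b,z): y\top a,\ z\top b\}$, $D_M=\{(x,a,y,b,z): x\top a,\ z\top b,\ C_{ab}\ne\emptyset\}$, by $\Gamma_0(x,a,y,b,z)=(1-P_a^xP_y^b)(z)$ on $D_L$, $=(1-P_b^zP_y^a)(x)$ on $D_R$, $=(P_x^a-P_b^z)(y)$ on $D_M$ (these agree on overlaps). A semitorsor is a set with a ternary map satisfying the para-associative law $(xy(zuv))=(x(uzy)v)=((xyz)uv)$. The opposite semitorsor is the same set with product $(x,y,z)\mapsto(zyx)$; a semitorsor is commutative if $(xyz)=(zyx)$ for all $x,y,z$. *)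

theory Defs
  imports "HOL-Library.Set_Algebras"
begin

(* The sort {comm_ring, comm_monoid_mult} is "commutative unital ring", and {ring, monoid_mult} is
   "unital ring". The classes comm_ring_1 and ring_1 (hence the locale module of HOL.Modules) would in
   addition require 0 \<noteq> 1, that is, exclude the zero ring. *)

locale unital_algebra =
  fixes smult :: "'k::{comm_ring, comm_monoid_mult} \<Rightarrow> 'b::{ring, monoid_mult} \<Rightarrow> 'b"
  assumes smult_add_right: "smult k (r + s) = smult k r + smult k s"
    and smult_add_left: "smult (k + l) r = smult k r + smult l r"
    and smult_smult: "smult k (smult l r) = smult (k * l) r"
    and smult_one: "smult 1 r = r"
    and mult_smult_left: "smult k r * s = smult k (r * s)"
    and mult_smult_right: "r * smult k s = smult k (r * s)"

locale right_module =
  fixes act :: "'w::ab_group_add \<Rightarrow> 'b::{ring, monoid_mult} \<Rightarrow> 'w"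
  assumes act_add_left: "act (v + w) r = act v r + act w r"
    and act_add_right: "act w (r + s) = act w r + act w s"
    and act_act: "act (act w r) s = act w (r * s)"
    and act_one: "act w 1 = w"

definition Gras :: "('w::ab_group_add \<Rightarrow> 'b::{ring, monoid_mult} \<Rightarrow> 'w) \<Rightarrow> 'w set set" where
  "Gras act = {U. 0 \<in> U \<and> (\<forall>v\<in>U. \<forall>w\<in>U. v + w \<in> U) \<and> (\<forall>w\<in>U. \<forall>r. act w r \<in> U)}"

(* For submodules x and a this says that W is the internal direct sum of x and a; x + a is the
   elementwise sum of sets. *)
definition transversal :: "'w::ab_group_add set \<Rightarrow> 'w set \<Rightarrow> bool" (infix "\<top>\<top>" 50) where
  "x \<top>\<top> a \<longleftrightarrow> x + a = UNIV \<and> x \<inter> a = {0}"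

definition common_complements ::
    "('w::ab_group_add \<Rightarrow> 'b::{ring, monoid_mult} \<Rightarrow> 'w) \<Rightarrow> 'w set \<Rightarrow> 'w set \<Rightarrow> 'w set set" where
  "common_complements act a b = {x \<in> Gras act. x \<top>\<top> a \<and> x \<top>\<top> b}"

definition linear_endo ::
    "('w::ab_group_add \<Rightarrow> 'b::{ring, monoid_mult} \<Rightarrow> 'w) \<Rightarrow> ('w \<Rightarrow> 'w) \<Rightarrow> bool" where
  "linear_endo act f \<longleftrightarrow>
     (\<forall>v w. f (v + w) = f v + f w) \<and> (\<forall>w r. f (act w r) = act (f w) r)"

(* proj act x a is the projector P_x^a onto x with kernel a; it is meaningful only if x and a are
   submodules with x \<top>\<top> a. *)
definition proj ::
    "('w::ab_group_add \<Rightarrow> 'b::{ring, monoid_mult} \<Rightarrow> 'w) \<Rightarrow> 'w set \<Rightarrow> 'w set \<Rightarrow> 'w \<Rightarrow> 'w" where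
  "proj act x a =
     (THE P. linear_endo act P \<and> P \<circ> P = P \<and> range P = x \<and> {w. P w = 0} = a)"

definition D_L :: "('w::ab_group_add \<Rightarrow> 'b::{ring, monoid_mult} \<Rightarrow> 'w)
    \<Rightarrow> ('w set \<times> 'w set \<times> 'w set \<times> 'w set \<times> 'w set) set" where
  "D_L act = {(x, a, y, b, z). {x, a, y, b, z} \<subseteq> Gras act \<and> x \<top>\<top> a \<and> y \<top>\<top> b}"

definition D_R :: "('w::ab_group_add \<Rightarrow> 'b::{ring, monoid_mult} \<Rightarrow> 'w)
    \<Rightarrow> ('w set \<times> 'w set \<times> 'w set \<times> 'w set \<times> 'w set) set" where
  "D_R act = {(x, a, y, b, z). {x, a, y, b, z} \<subseteq> Gras act \<and> y \<top>\<top> a \<and> z \<top>\<top> b}"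

definition D_M :: "('w::ab_group_add \<Rightarrow> 'b::{ring, monoid_mult} \<Rightarrow> 'w)
    \<Rightarrow> ('w set \<times> 'w set \<times> 'w set \<times> 'w set \<times> 'w set) set" where
  "D_M act = {(x, a, y, b, z). {x, a, y, b, z} \<subseteq> Gras act \<and> x \<top>\<top> a \<and> z \<top>\<top> b
                \<and> common_complements act a b \<noteq> {}}"

(* The partial map Gamma_0 is represented by its graph: Gamma0 act x a y b z s says that
   (x, a, y, b, z) lies in the domain D_L \<union> D_R \<union> D_M and that one of the applicable formulas
   gives the value s. An everywhere defined \<Gamma> extends Gamma_0 iff Gamma0 act x a y b z s
   implies \<Gamma> x a y b z = s; this includes agreement of the three formulas on overlaps. *)
inductive Gamma0 :: "('w::ab_group_add \<Rightarrow> 'b::{ring, monoid_mult} \<Rightarrow> 'w)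
    \<Rightarrow> 'w set \<Rightarrow> 'w set \<Rightarrow> 'w set \<Rightarrow> 'w set \<Rightarrow> 'w set \<Rightarrow> 'w set \<Rightarrow> bool"
  for act where
  left: "(x, a, y, b, z) \<in> D_L act \<Longrightarrow>
     Gamma0 act x a y b z ((\<lambda>w. w - proj act a x (proj act y b w)) ` z)"
| right: "(x, a, y, b, z) \<in> D_R act \<Longrightarrow>
     Gamma0 act x a y b z ((\<lambda>w. w - proj act b z (proj act y a w)) ` x)"
| middle: "(x, a, y, b, z) \<in> D_M act \<Longrightarrow>
     Gamma0 act x a y b z ((\<lambda>w. proj act x a w - proj act b z w) ` y)"

definition Gamma :: "'w::ab_group_add set \<Rightarrow> 'w set \<Rightarrow> 'w set \<Rightarrow> 'w set \<Rightarrow> 'w set \<Rightarrow> 'w set"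
    ("\<Gamma>") where
  "\<Gamma> x a y b z = {\<omega>. \<exists>\<xi>\<in>x. \<exists>\<alpha>\<in>a. \<exists>\<eta>\<in>y. \<exists>\<beta>\<in>b. \<exists>\<zeta>\<in>z.
       \<omega> = \<zeta> + \<alpha> \<and> \<omega> = \<alpha> + \<eta> + \<beta> \<and> \<omega> = \<xi> + \<beta>}"

definition semitorsor :: "'s set \<Rightarrow> ('s \<Rightarrow> 's \<Rightarrow> 's \<Rightarrow> 's) \<Rightarrow> bool" where
  "semitorsor S t \<longleftrightarrow>
     (\<forall>x\<in>S. \<forall>y\<in>S. \<forall>z\<in>S. t x y z \<in> S) \<and>
     (\<forall>x\<in>S. \<forall>y\<in>S. \<forall>z\<in>S. \<forall>u\<in>S. \<forall>v\<in>S.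
        t x y (t z u v) = t x (t u z y) v \<and> t x (t u z y) v = t (t x y z) u v)"

definition commutative_semitorsor :: "'s set \<Rightarrow> ('s \<Rightarrow> 's \<Rightarrow> 's \<Rightarrow> 's) \<Rightarrow> bool" where
  "commutative_semitorsor S t \<longleftrightarrow>
     semitorsor S t \<and> (\<forall>x\<in>S. \<forall>y\<in>S. \<forall>z\<in>S. t x y z = t z y x)"

definition opposite :: "('s \<Rightarrow> 's \<Rightarrow> 's \<Rightarrow> 's) \<Rightarrow> 's \<Rightarrow> 's \<Rightarrow> 's \<Rightarrow> 's" where
  "opposite t = (\<lambda>x y z. t z y x)"

definition prod_ab ::
    "'w::ab_group_add set \<Rightarrow> 'w set \<Rightarrow> 'w set \<Rightarrow> 'w set \<Rightarrow> 'w set \<Rightarrow> 'w set" where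
  "prod_ab a b = (\<lambda>x y z. \<Gamma> x a y b z)"

end

theory Submission
  imports Defs
begin

text \<open>
  Solving the defining equations of \<open>\<Gamma>\<close> for \<open>\<xi>\<close>, \<open>\<eta>\<close>, \<open>\<zeta>\<close> leaves a description by \<open>\<alpha>\<close> and \<open>\<beta>\<close>
  alone: \<open>\<omega> \<in> \<Gamma> x a y b z\<close> iff there are \<open>\<alpha> \<in> a\<close> and \<open>\<beta> \<in> b\<close> with \<open>\<omega> - \<beta> \<in> x\<close>,
  \<open>\<omega> - \<alpha> - \<beta> \<in> y\<close> and \<open>\<omega> - \<alpha> \<in> z\<close>. Each para-associative law then amounts to an invertible
  additive substitution between the pairs of parameters of a nested product. On the domain of
  \<open>\<Gamma>\<^sub>0\<close>, transversality makes all five variables projections of a single free one (\<open>\<zeta>\<close>, \<open>\<xi>\<close> or \<open>\<eta>\<close>),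
  which gives the three formulas.
\<close>

section \<open>Membership in \<open>\<Gamma>\<close> through two parameters\<close>

lemma Gamma_iff:
  "\<omega> \<in> \<Gamma> x a y b z \<longleftrightarrow> (\<exists>\<alpha>\<in>a. \<exists>\<beta>\<in>b. \<omega> - \<beta> \<in> x \<and> \<omega> - \<alpha> - \<beta> \<in> y \<and> \<omega> - \<alpha> \<in> z)"
proof
  assume "\<omega> \<in> \<Gamma> x a y b z"
  then obtain \<xi> \<alpha> \<eta> \<beta> \<zeta> where m: "\<xi> \<in> x" "\<alpha> \<in> a" "\<eta> \<in> y" "\<beta> \<in> b" "\<zeta> \<in> z"
    and e: "\<omega> = \<zeta> + \<alpha>" "\<omega> = \<alpha> + \<eta> + \<beta>" "\<omega> = \<xi> + \<beta>"
    unfolding Gamma_def by auto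
  have "\<omega> - \<beta> = \<xi>" using e(3) by simp
  moreover have "\<omega> - \<alpha> - \<beta> = \<eta>" using e(2) by simp
  moreover have "\<omega> - \<alpha> = \<zeta>" using e(1) by simp
  ultimately show "\<exists>\<alpha>\<in>a. \<exists>\<beta>\<in>b. \<omega> - \<beta> \<in> x \<and> \<omega> - \<alpha> - \<beta> \<in> y \<and> \<omega> - \<alpha> \<in> z"
    using m by metis
next
  assume "\<exists>\<alpha>\<in>a. \<exists>\<beta>\<in>b. \<omega> - \<beta> \<in> x \<and> \<omega> - \<alpha> - \<beta> \<in> y \<and> \<omega> - \<alpha> \<in> z"
  then obtain \<alpha> \<beta> where m: "\<alpha> \<in> a" "\<beta> \<in> b" "\<omega> - \<beta> \<in> x" "\<omega> - \<alpha> - \<beta> \<in> y" "\<omega> - \<alpha> \<in> z"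
    by blast
  have "\<omega> = (\<omega> - \<alpha>) + \<alpha>" "\<omega> = \<alpha> + (\<omega> - \<alpha> - \<beta>) + \<beta>" "\<omega> = (\<omega> - \<beta>) + \<beta>"
    by (simp_all add: algebra_simps)
  with m show "\<omega> \<in> \<Gamma> x a y b z"
    unfolding Gamma_def by blast
qed

lemma GammaI:
  assumes "\<alpha> \<in> a" "\<beta> \<in> b" "\<omega> - \<beta> \<in> x" "\<omega> - \<alpha> - \<beta> \<in> y" "\<omega> - \<alpha> \<in> z"
  shows "\<omega> \<in> \<Gamma> x a y b z"
  using assms Gamma_iff by blast

lemma GammaE:
  assumes "\<omega> \<in> \<Gamma> x a y b z"
  obtains \<alpha> \<beta> where "\<alpha> \<in> a" "\<beta> \<in> b" "\<omega> - \<beta> \<in> x" "\<omega> - \<alpha> - \<beta> \<in> y" "\<omega> - \<alpha> \<in> z"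
  using assms Gamma_iff by blast

text \<open>Exchanging the parameters \<alpha> and \<beta> permutes the membership conditions,
  because \<omega> - \<alpha> - \<beta> is symmetric in them.\<close>

lemma Gamma_reverse: "\<Gamma> x a y b z = \<Gamma> z b y a x"
proof -
  \<comment> \<open>Generalised over all five sets, so that the converse inclusion is another
    instance.\<close>
  have "\<Gamma> x a y b z \<subseteq> \<Gamma> z b y a x" for x a y b z :: "'a set"
  proof
    fix \<omega> assume "\<omega> \<in> \<Gamma> x a y b z"
    then obtain \<alpha> \<beta> where w: "\<alpha> \<in> a" "\<beta> \<in> b" "\<omega> - \<beta> \<in> x" "\<omega> - \<alpha> - \<beta> \<in> y" "\<omega> - \<alpha> \<in> z"
      by (rule GammaE)
    from w(4) have "\<omega> - \<beta> - \<alpha> \<in> y" by (simp add: algebra_simps)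
    with w show "\<omega> \<in> \<Gamma> z b y a x" by (intro GammaI[of \<beta> _ \<alpha>])
  qed
  then show ?thesis by blast
qed

section \<open>Submodules and transversal pairs\<close>

lemma Gras_zero: "U \<in> Gras act \<Longrightarrow> 0 \<in> U"
  and Gras_add: "U \<in> Gras act \<Longrightarrow> v \<in> U \<Longrightarrow> w \<in> U \<Longrightarrow> v + w \<in> U"
  and Gras_act: "U \<in> Gras act \<Longrightarrow> w \<in> U \<Longrightarrow> act w r \<in> U"
  by (auto simp: Gras_def)

lemma transversal_decomp_exists:
  assumes "x \<top>\<top> a"
  obtains p where "p \<in> x" "w - p \<in> a"
proof -
  have "w \<in> x + a" using assms by (simp add: transversal_def)
  then obtain p c where "p \<in> x" "c \<in> a" "w = p + c" by (rule set_plus_elim)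
  then show thesis by (intro that[of p]) auto
qed

lemma transversal_sym:
  assumes "x \<top>\<top> a"
  shows "a \<top>\<top> x"
  using assms by (simp add: transversal_def add.commute Int_commute)

context right_module
begin

lemma act_zero_left: "act 0 r = 0"
  using act_add_left[of 0 0 r] by simp

lemma act_zero_right: "act w 0 = 0"
  using act_add_right[of w 0 0] by simp

lemma act_minus_left: "act (- v) r = - act v r"
  using act_add_left[of "- v" v r] by (simp add: act_zero_left eq_neg_iff_add_eq_0)

lemma act_diff_left: "act (v - w) r = act v r - act w r"
  using act_add_left[of v "- w" r] by (simp add: act_minus_left)

lemma act_minus_one: "act w (- 1) = - w"
  using act_add_right[of w "- 1" 1] by (simp add: act_zero_right act_one eq_neg_iff_add_eq_0)

text \<open>\<open>Gras\<close> does not list negation among its closure conditions; it is the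
  action of \<open>- 1\<close>.\<close>

lemma Gras_minus: "U \<in> Gras act \<Longrightarrow> w \<in> U \<Longrightarrow> - w \<in> U"
  using Gras_act[of U act w "- 1"] by (simp add: act_minus_one)

lemma Gras_diff: "U \<in> Gras act \<Longrightarrow> v \<in> U \<Longrightarrow> w \<in> U \<Longrightarrow> v - w \<in> U"
  using Gras_add[of U act v "- w"] Gras_minus by simp

lemma Gras_diff_swap: "U \<in> Gras act \<Longrightarrow> v - w \<in> U \<Longrightarrow> w - v \<in> U"
  using Gras_minus[of U "v - w"] by simp

section \<open>Closure of the submodules under \<open>\<Gamma>\<close>, and the second Klein
  symmetry\<close>

lemma Gamma_in_Gras:
  assumes "x \<in> Gras act" "a \<in> Gras act" "y \<in> Gras act" "b \<in> Gras act" "z \<in> Gras act"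
  shows "\<Gamma> x a y b z \<in> Gras act"
proof -
  have "0 \<in> \<Gamma> x a y b z"
    by (rule GammaI[of 0 _ 0]) (use assms Gras_zero in auto)
  moreover have "v + w \<in> \<Gamma> x a y b z" if v: "v \<in> \<Gamma> x a y b z" and w: "w \<in> \<Gamma> x a y b z" for v w
  proof -
    from v obtain \<alpha> \<beta> where v': "\<alpha> \<in> a" "\<beta> \<in> b" "v - \<beta> \<in> x" "v - \<alpha> - \<beta> \<in> y" "v - \<alpha> \<in> z"
      by (rule GammaE)
    from w obtain \<alpha>' \<beta>'
      where w': "\<alpha>' \<in> a" "\<beta>' \<in> b" "w - \<beta>' \<in> x" "w - \<alpha>' - \<beta>' \<in> y" "w - \<alpha>' \<in> z"
      by (rule GammaE)
    \<comment> \<open>The membership conditions are linear in \<omega>, \<alpha> and \<beta>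
      jointly, so the witnesses for a sum are the sums of the witnesses.\<close>
    show ?thesis
    proof (rule GammaI)
      show "\<alpha> + \<alpha>' \<in> a" "\<beta> + \<beta>' \<in> b"
        using v' w' assms Gras_add by blast+
      show "v + w - (\<beta> + \<beta>') \<in> x"
        using Gras_add[OF assms(1) v'(3) w'(3)] by (simp add: algebra_simps)
      show "v + w - (\<alpha> + \<alpha>') - (\<beta> + \<beta>') \<in> y"
        using Gras_add[OF assms(3) v'(4) w'(4)] by (simp add: algebra_simps)
      show "v + w - (\<alpha> + \<alpha>') \<in> z"
        using Gras_add[OF assms(5) v'(5) w'(5)] by (simp add: algebra_simps)
    qed
  qed
  moreover have "act w r \<in> \<Gamma> x a y b z" if w: "w \<in> \<Gamma> x a y b z" for w r
  proof -
    from w obtain \<alpha> \<beta> where w': "\<alpha> \<in> a" "\<beta> \<in> b" "w - \<beta> \<in> x" "w - \<alpha> - \<beta> \<in> y" "w - \<alpha> \<in> z"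
      by (rule GammaE)
    show ?thesis
      by (rule GammaI[of "act \<alpha> r" _ "act \<beta> r"])
        (use w' assms in \<open>auto simp: act_diff_left[symmetric] intro: Gras_act\<close>)
  qed
  ultimately show ?thesis
    by (simp add: Gras_def)
qed

text \<open>The new parameters are \<xi> = \<omega> - \<beta> and \<zeta> = \<omega> - \<alpha>.
  Then \<omega> - \<zeta> = \<alpha> and \<omega> - \<xi> = \<beta>, while the middle element
  becomes \<alpha> + \<beta> - \<omega>, the negative of \<eta>.\<close>

lemma Gamma_swap_subset:
  assumes "x \<in> Gras act" "a \<in> Gras act" "y \<in> Gras act" "b \<in> Gras act" "z \<in> Gras act"
  shows "\<Gamma> x a y b z \<subseteq> \<Gamma> a x y z b"
proof
  fix \<omega> assume "\<omega> \<in> \<Gamma> x a y b z"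
  then obtain \<alpha> \<beta> where w: "\<alpha> \<in> a" "\<beta> \<in> b" "\<omega> - \<beta> \<in> x" "\<omega> - \<alpha> - \<beta> \<in> y" "\<omega> - \<alpha> \<in> z"
    by (rule GammaE)
  show "\<omega> \<in> \<Gamma> a x y z b"
    by (rule GammaI[OF w(3,5)]) (use w Gras_minus[OF assms(3) w(4)] in \<open>simp_all add: algebra_simps\<close>)
qed

lemma Gamma_swap:
  assumes "x \<in> Gras act" "a \<in> Gras act" "y \<in> Gras act" "b \<in> Gras act" "z \<in> Gras act"
  shows "\<Gamma> x a y b z = \<Gamma> a x y z b"
  \<comment> \<open>The exchange of arguments is an involution, so the same inclusion serves in both
    directions.\<close>
  using Gamma_swap_subset assms by blast

section \<open>The para-associative law\<close>

lemma Gamma_nested_right_iff: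
  "\<omega> \<in> \<Gamma> x a u b (\<Gamma> y a v b z) \<longleftrightarrow>
    (\<exists>\<alpha>\<in>a. \<exists>\<alpha>'\<in>a. \<exists>\<beta>\<in>b. \<exists>\<beta>'\<in>b. \<omega> - \<beta> \<in> x \<and> \<omega> - \<alpha> - \<beta> \<in> u \<and> \<omega> - \<alpha> - \<beta>' \<in> y
      \<and> \<omega> - \<alpha> - \<alpha>' - \<beta>' \<in> v \<and> \<omega> - \<alpha> - \<alpha>' \<in> z)"
  \<comment> \<open>Unprimed parameters belong to the outer product; primed ones belong to the inner
    product, whose element is \<omega> - \<alpha>.\<close>
  unfolding Gamma_iff by blast

text \<open>The parameters of the right-nested product become (\<alpha> + \<alpha>', \<beta>') for
  the outer and (\<alpha>, \<beta> - \<beta>') for the inner product on the other side. This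
  substitution is invertible within \<open>a\<close> and \<open>b\<close>, and the five conditions
  correspond.\<close>

lemma Gamma_assoc_outer:
  assumes a: "a \<in> Gras act" and b: "b \<in> Gras act"
  shows "\<Gamma> x a u b (\<Gamma> y a v b z) = \<Gamma> (\<Gamma> x a u b y) a v b z"
proof (rule set_eqI, rule iffI)
  fix \<omega> assume "\<omega> \<in> \<Gamma> x a u b (\<Gamma> y a v b z)"
  then obtain \<alpha> \<alpha>' \<beta> \<beta>' where m: "\<alpha> \<in> a" "\<alpha>' \<in> a" "\<beta> \<in> b" "\<beta>' \<in> b"
    and w: "\<omega> - \<beta> \<in> x" "\<omega> - \<alpha> - \<beta> \<in> u" "\<omega> - \<alpha> - \<beta>' \<in> y" "\<omega> - \<alpha> - \<alpha>' - \<beta>' \<in> v" "\<omega> - \<alpha> - \<alpha>' \<in> z"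
    unfolding Gamma_nested_right_iff by blast
  have "\<omega> - \<beta>' \<in> \<Gamma> x a u b y"
    by (rule GammaI[OF m(1) Gras_diff[OF b m(3,4)]]) (use w in \<open>simp_all add: algebra_simps\<close>)
  then show "\<omega> \<in> \<Gamma> (\<Gamma> x a u b y) a v b z"
    by (rule GammaI[OF Gras_add[OF a m(1,2)] m(4)]) (use w in \<open>simp_all add: algebra_simps\<close>)
next
  fix \<omega> assume "\<omega> \<in> \<Gamma> (\<Gamma> x a u b y) a v b z"
  then obtain \<alpha> \<beta> where m: "\<alpha> \<in> a" "\<beta> \<in> b"
    and w: "\<omega> - \<beta> \<in> \<Gamma> x a u b y" "\<omega> - \<alpha> - \<beta> \<in> v" "\<omega> - \<alpha> \<in> z"
    by (rule GammaE)
  from w(1) obtain \<alpha>' \<beta>' where m': "\<alpha>' \<in> a" "\<beta>' \<in> b"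
    and w': "\<omega> - \<beta> - \<beta>' \<in> x" "\<omega> - \<beta> - \<alpha>' - \<beta>' \<in> u" "\<omega> - \<beta> - \<alpha>' \<in> y"
    by (rule GammaE)
  have "\<omega> - \<alpha>' \<in> \<Gamma> y a v b z"
    by (rule GammaI[OF Gras_diff[OF a m(1) m'(1)] m(2)]) (use w w' in \<open>simp_all add: algebra_simps\<close>)
  then show "\<omega> \<in> \<Gamma> x a u b (\<Gamma> y a v b z)"
    by (rule GammaI[OF m'(1) Gras_add[OF b m(2) m'(2)], rotated 2])
      (use w' in \<open>simp_all add: algebra_simps\<close>)
qed

text \<open>Here the outer parameters become (\<alpha> + \<alpha>', \<beta>) and the inner ones (-
  \<alpha>', \<beta>' - \<beta>). The sign reflects that the middle product lists \<open>v\<close>,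
  \<open>y\<close>, \<open>u\<close> in reversed order.\<close>

lemma Gamma_assoc_inner:
  assumes a: "a \<in> Gras act" and b: "b \<in> Gras act"
  shows "\<Gamma> x a u b (\<Gamma> y a v b z) = \<Gamma> x a (\<Gamma> v a y b u) b z"
proof (rule set_eqI, rule iffI)
  fix \<omega> assume "\<omega> \<in> \<Gamma> x a u b (\<Gamma> y a v b z)"
  then obtain \<alpha> \<alpha>' \<beta> \<beta>' where m: "\<alpha> \<in> a" "\<alpha>' \<in> a" "\<beta> \<in> b" "\<beta>' \<in> b"
    and w: "\<omega> - \<beta> \<in> x" "\<omega> - \<alpha> - \<beta> \<in> u" "\<omega> - \<alpha> - \<beta>' \<in> y" "\<omega> - \<alpha> - \<alpha>' - \<beta>' \<in> v" "\<omega> - \<alpha> - \<alpha>' \<in> z"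
    unfolding Gamma_nested_right_iff by blast
  have "\<omega> - (\<alpha> + \<alpha>') - \<beta> \<in> \<Gamma> v a y b u"
    by (rule GammaI[OF Gras_minus[OF a m(2)] Gras_diff[OF b m(4,3)]])
      (use w in \<open>simp_all add: algebra_simps\<close>)
  then show "\<omega> \<in> \<Gamma> x a (\<Gamma> v a y b u) b z"
    by (rule GammaI[OF Gras_add[OF a m(1,2)] m(3), rotated]) (use w in \<open>simp_all add: algebra_simps\<close>)
next
  fix \<omega> assume "\<omega> \<in> \<Gamma> x a (\<Gamma> v a y b u) b z"
  then obtain \<alpha> \<beta> where m: "\<alpha> \<in> a" "\<beta> \<in> b"
    and w: "\<omega> - \<beta> \<in> x" "\<omega> - \<alpha> - \<beta> \<in> \<Gamma> v a y b u" "\<omega> - \<alpha> \<in> z"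
    by (rule GammaE)
  from w(2) obtain \<alpha>' \<beta>' where m': "\<alpha>' \<in> a" "\<beta>' \<in> b"
    and w': "\<omega> - \<alpha> - \<beta> - \<beta>' \<in> v" "\<omega> - \<alpha> - \<beta> - \<alpha>' - \<beta>' \<in> y" "\<omega> - \<alpha> - \<beta> - \<alpha>' \<in> u"
    by (rule GammaE)
  have "\<omega> - (\<alpha> + \<alpha>') \<in> \<Gamma> y a v b z"
    by (rule GammaI[OF Gras_minus[OF a m'(1)] Gras_add[OF b m(2) m'(2)]])
      (use w w' in \<open>simp_all add: algebra_simps\<close>)
  then show "\<omega> \<in> \<Gamma> x a u b (\<Gamma> y a v b z)"
    by (rule GammaI[OF Gras_add[OF a m(1) m'(1)] m(2), rotated 2])
      (use w(1) w' in \<open>simp_all add: algebra_simps\<close>)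
qed

section \<open>Projectors along transversal pairs\<close>

lemma transversal_decomp_unique:
  assumes "x \<in> Gras act" "a \<in> Gras act" "x \<top>\<top> a"
    and "p \<in> x" "w - p \<in> a" "q \<in> x" "w - q \<in> a"
  shows "p = q"
proof -
  have "p - q \<in> x" using assms Gras_diff by blast
  moreover have "p - q \<in> a" using Gras_diff[OF assms(2) assms(7,5)] by simp
  ultimately have "p - q \<in> {0}" using assms(3) unfolding transversal_def by blast
  then show ?thesis by simp
qed

text \<open>Since \<open>proj\<close> is a definite description, this needs both existence and
  uniqueness of the projector. Afterwards only the decomposition of \<open>w\<close> along
  \<open>x\<close> and \<open>a\<close> is used.\<close>

lemma proj_characterization:
  assumes x: "x \<in> Gras act" and a: "a \<in> Gras act" and t: "x \<top>\<top> a"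
  shows "proj act x a w \<in> x \<and> w - proj act x a w \<in> a"
proof -
  let ?is_proj = "\<lambda>P. linear_endo act P \<and> P \<circ> P = P \<and> range P = x \<and> {w. P w = 0} = a"
  have "\<exists>p. p \<in> x \<and> w - p \<in> a" for w
    using transversal_decomp_exists[OF t] by metis
  then obtain P where P: "\<And>w. P w \<in> x" "\<And>w. w - P w \<in> a" by metis
  have eq: "P w = p" if "p \<in> x" "w - p \<in> a" for w p
    using transversal_decomp_unique[OF x a t P that] .
  have fix_x: "P w = w" if "w \<in> x" for w
    by (rule eq) (use that Gras_zero[OF a] in auto)
  have "linear_endo act P"
    unfolding linear_endo_def
  \<comment> \<open>By \<open>eq\<close>, each linearity law only requires its right-hand side to be
    the \<open>x\<close>-component of the argument on the left.\<close>
  proof (intro conjI allI eq)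
    fix v w r
    show "P v + P w \<in> x" "act (P w) r \<in> x"
      using P Gras_add[OF x] Gras_act[OF x] by blast+
    show "v + w - (P v + P w) \<in> a"
      using Gras_add[OF a P(2)[of v] P(2)[of w]] by (simp add: algebra_simps)
    show "act w r - act (P w) r \<in> a"
      using Gras_act[OF a P(2)] by (simp add: act_diff_left[symmetric])
  qed
  moreover have "P \<circ> P = P"
    using fix_x P(1) by (simp add: fun_eq_iff)
  moreover have "range P = x"
  proof
    show "x \<subseteq> range P" by (metis fix_x rangeI subsetI)
  qed (use P(1) in auto)
  moreover have "{w. P w = 0} = a"
  proof (intro set_eqI iffI)
    show "w \<in> a" if "w \<in> {w. P w = 0}" for w using P(2)[of w] that by simp
    show "w \<in> {w. P w = 0}" if "w \<in> a" for w
      using eq[of 0 w] Gras_zero[OF x] that by simp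
  qed
  ultimately have "?is_proj P" by blast
  \<comment> \<open>Any competitor \<open>Q\<close> also splits \<open>w\<close> into
    \<open>Q w\<close> in \<open>x\<close> and \<open>w - Q w\<close> in its kernel
    \<open>a\<close>, so uniqueness of the decomposition forces equality.\<close>
  moreover have "Q = P" if Q: "?is_proj Q" for Q
  proof
    fix w
    have add: "Q (u + v) = Q u + Q v" for u v
      using Q by (simp add: linear_endo_def)
    have "Q w = Q (w - Q w) + Q (Q w)"
      using add[of "w - Q w" "Q w"] by simp
    moreover have "Q (Q w) = Q w"
      using Q by (metis comp_apply)
    ultimately have "Q (w - Q w) = 0" by simp
    then have "w - Q w \<in> a" using Q by blast
    moreover have "Q w \<in> x" using Q by blast
    ultimately show "Q w = P w" using eq by metis
  qed
  ultimately have "proj act x a = P"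
    unfolding proj_def by (rule the_equality)
  with P show ?thesis by simp
qed

lemma proj_in: "x \<in> Gras act \<Longrightarrow> a \<in> Gras act \<Longrightarrow> x \<top>\<top> a \<Longrightarrow> proj act x a w \<in> x"
  and diff_proj_in: "x \<in> Gras act \<Longrightarrow> a \<in> Gras act \<Longrightarrow> x \<top>\<top> a \<Longrightarrow> w - proj act x a w \<in> a"
  by (simp_all add: proj_characterization)

lemma proj_eqI:
  assumes "x \<in> Gras act" "a \<in> Gras act" "x \<top>\<top> a" "p \<in> x" "w - p \<in> a"
  shows "proj act x a w = p"
  by (rule transversal_decomp_unique[OF assms(1-3) proj_in[OF assms(1-3)] diff_proj_in[OF assms(1-3)]
        assms(4,5)])

section \<open>Agreement with the three formulas of \<open>Gamma0\<close>\<close>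

lemma Gamma_left:
  assumes "(x, a, y, b, z) \<in> D_L act"
  shows "\<Gamma> x a y b z = (\<lambda>w. w - proj act a x (proj act y b w)) ` z"
proof -
  have G: "x \<in> Gras act" "a \<in> Gras act" "y \<in> Gras act" "b \<in> Gras act"
    and t: "a \<top>\<top> x" "y \<top>\<top> b"
    using assms transversal_sym by (auto simp: D_L_def)
  show ?thesis
  proof (intro set_eqI iffI)
    fix \<omega> assume "\<omega> \<in> \<Gamma> x a y b z"
    then obtain \<alpha> \<beta> where w: "\<alpha> \<in> a" "\<beta> \<in> b" "\<omega> - \<beta> \<in> x" "\<omega> - \<alpha> - \<beta> \<in> y" "\<omega> - \<alpha> \<in> z"
      by (rule GammaE)
    \<comment> \<open>The free variable is \<zeta> = \<omega> - \<alpha> = \<eta> + \<beta>, whose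
      \<open>y\<close>-component is \<eta>; in turn \<eta> = - \<alpha> + \<xi> has
      \<open>a\<close>-component - \<alpha>. Hence \<omega> = \<zeta> + \<alpha> is the required
      difference.\<close>
    have "proj act y b (\<omega> - \<alpha>) = \<omega> - \<alpha> - \<beta>"
      by (rule proj_eqI) (use G t w in auto)
    moreover have "proj act a x (\<omega> - \<alpha> - \<beta>) = - \<alpha>"
      by (rule proj_eqI) (use G t w Gras_minus in \<open>auto simp: algebra_simps\<close>)
    ultimately show "\<omega> \<in> (\<lambda>w. w - proj act a x (proj act y b w)) ` z"
      using w(5) by (intro image_eqI[of _ _ "\<omega> - \<alpha>"]) auto
  next
    fix \<omega> assume "\<omega> \<in> (\<lambda>w. w - proj act a x (proj act y b w)) ` z"
    then obtain \<zeta> where z: "\<zeta> \<in> z" "\<omega> = \<zeta> - proj act a x (proj act y b \<zeta>)" by blast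
    define \<eta> where "\<eta> = proj act y b \<zeta>"
    define \<delta> where "\<delta> = proj act a x \<eta>"
    have "\<eta> \<in> y" "\<zeta> - \<eta> \<in> b" "\<delta> \<in> a" "\<eta> - \<delta> \<in> x" "\<omega> = \<zeta> - \<delta>"
      using G t z by (auto simp: \<eta>_def \<delta>_def intro: proj_in diff_proj_in)
    then show "\<omega> \<in> \<Gamma> x a y b z"
      using z(1) Gras_minus[OF G(2)] by (intro GammaI[of "- \<delta>" _ "\<zeta> - \<eta>"]) (auto simp: algebra_simps)
  qed
qed

text \<open>Reversing the five arguments carries \<open>D_R\<close> into \<open>D_L\<close> and one
  formula into the other.\<close>

lemma Gamma_right:
  assumes "(x, a, y, b, z) \<in> D_R act"
  shows "\<Gamma> x a y b z = (\<lambda>w. w - proj act b z (proj act y a w)) ` x"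
proof -
  have "(z, b, y, a, x) \<in> D_L act"
    using assms by (auto simp: D_R_def D_L_def)
  then show ?thesis
    by (subst Gamma_reverse) (rule Gamma_left)
qed

lemma Gamma_middle:
  assumes "(x, a, y, b, z) \<in> D_M act"
  shows "\<Gamma> x a y b z = (\<lambda>w. proj act x a w - proj act b z w) ` y"
proof -
  have G: "x \<in> Gras act" "a \<in> Gras act" "b \<in> Gras act" "z \<in> Gras act"
    and t: "x \<top>\<top> a" "b \<top>\<top> z"
    using assms transversal_sym by (auto simp: D_M_def)
  show ?thesis
  proof (intro set_eqI iffI)
    fix \<omega> assume "\<omega> \<in> \<Gamma> x a y b z"
    then obtain \<alpha> \<beta> where w: "\<alpha> \<in> a" "\<beta> \<in> b" "\<omega> - \<beta> \<in> x" "\<omega> - \<alpha> - \<beta> \<in> y" "\<omega> - \<alpha> \<in> z"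
      by (rule GammaE)
    \<comment> \<open>Now \<eta> = \<omega> - \<alpha> - \<beta> is free. It splits as \<xi> -
      \<alpha> along \<open>x\<close>, \<open>a\<close> and as - \<beta> + \<zeta> along
      \<open>b\<close>, \<open>z\<close>, so \<omega> = \<xi> + \<beta> is the difference of the two
      projections.\<close>
    have "proj act x a (\<omega> - \<alpha> - \<beta>) = \<omega> - \<beta>"
      by (rule proj_eqI) (use G t w Gras_minus in auto)
    moreover have "proj act b z (\<omega> - \<alpha> - \<beta>) = - \<beta>"
      by (rule proj_eqI) (use G t w Gras_minus in auto)
    ultimately show "\<omega> \<in> (\<lambda>w. proj act x a w - proj act b z w) ` y"
      using w(4) by (intro image_eqI[of _ _ "\<omega> - \<alpha> - \<beta>"]) auto
  next
    fix \<omega> assume "\<omega> \<in> (\<lambda>w. proj act x a w - proj act b z w) ` y"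
    then obtain \<eta> where y: "\<eta> \<in> y" "\<omega> = proj act x a \<eta> - proj act b z \<eta>" by blast
    define \<xi> where "\<xi> = proj act x a \<eta>"
    define \<delta> where "\<delta> = proj act b z \<eta>"
    have "\<xi> \<in> x" "\<eta> - \<xi> \<in> a" "\<delta> \<in> b" "\<eta> - \<delta> \<in> z" "\<omega> = \<xi> - \<delta>"
      using G t y by (auto simp: \<xi>_def \<delta>_def intro: proj_in diff_proj_in)
    then show "\<omega> \<in> \<Gamma> x a y b z"
      using y(1) Gras_minus[OF G(3)] Gras_diff_swap[OF G(2)]
      by (intro GammaI[of "\<xi> - \<eta>" _ "- \<delta>"]) (auto simp: algebra_simps)
  qed
qed

text \<open>Every clause yields the same value \<open>\<Gamma> x a y b z\<close>, so the formulas
  also agree wherever their domains overlap.\<close>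

lemma Gamma_extends_Gamma0:
  assumes "Gamma0 act x a y b z s"
  shows "\<Gamma> x a y b z = s"
  using assms by cases (simp_all add: Gamma_left Gamma_right Gamma_middle)

section \<open>Semitorsor structures and the combined result\<close>

lemma semitorsor_prod_ab:
  assumes "a \<in> Gras act" "b \<in> Gras act"
  shows "semitorsor (Gras act) (prod_ab a b)"
  unfolding semitorsor_def prod_ab_def
  using assms Gamma_in_Gras Gamma_assoc_outer[OF assms] Gamma_assoc_inner[OF assms] by metis

text \<open>With both parameters equal to \<open>a\<close>, \<open>Gamma_reverse\<close> exchanges
  only the outer factors and so becomes commutativity.\<close>

lemma commutative_semitorsor_prod_aa:
  assumes "a \<in> Gras act"
  shows "commutative_semitorsor (Gras act) (prod_ab a a)"
  unfolding commutative_semitorsor_def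
  using semitorsor_prod_ab[OF assms assms] Gamma_reverse unfolding prod_ab_def by blast

end

theorem theorem2p3:
  fixes smult :: "'k::{comm_ring, comm_monoid_mult} \<Rightarrow> 'b::{ring, monoid_mult} \<Rightarrow> 'b"
    and act :: "'w::ab_group_add \<Rightarrow> 'b \<Rightarrow> 'w"
    and X :: "'w set set"
  assumes "unital_algebra smult"
    and "right_module act"
    and X_def: "X = Gras act"
  shows
    "(\<forall>x\<in>X. \<forall>a\<in>X. \<forall>y\<in>X. \<forall>b\<in>X. \<forall>z\<in>X. \<Gamma> x a y b z \<in> X)
     \<and> (\<forall>x a y b z s. Gamma0 act x a y b z s \<longrightarrow> \<Gamma> x a y b z = s)
     \<and> (\<forall>x\<in>X. \<forall>a\<in>X. \<forall>y\<in>X. \<forall>b\<in>X. \<forall>z\<in>X.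
          \<Gamma> x a y b z = \<Gamma> z b y a x \<and> \<Gamma> x a y b z = \<Gamma> a x y z b)
     \<and> (\<forall>a\<in>X. \<forall>b\<in>X.
          semitorsor X (prod_ab a b)
          \<and> (\<forall>x\<in>X. \<forall>u\<in>X. \<forall>y\<in>X. \<forall>v\<in>X. \<forall>z\<in>X.
               \<Gamma> x a u b (\<Gamma> y a v b z) = \<Gamma> x a (\<Gamma> v a y b u) b z
               \<and> \<Gamma> x a (\<Gamma> v a y b u) b z = \<Gamma> (\<Gamma> x a u b y) a v b z)
          \<and> (\<forall>x\<in>X. \<forall>y\<in>X. \<forall>z\<in>X.
               prod_ab b a x y z = opposite (prod_ab a b) x y z))
     \<and> (\<forall>a\<in>X. commutative_semitorsor X (prod_ab a a))"
proof -
  interpret right_module act by fact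
  show ?thesis
    unfolding X_def
  proof (intro conjI ballI allI impI)
    fix a b x u y v z
    assume ab: "a \<in> Gras act" "b \<in> Gras act"
    show "\<Gamma> x a u b (\<Gamma> y a v b z) = \<Gamma> x a (\<Gamma> v a y b u) b z"
      by (rule Gamma_assoc_inner[OF ab])
    then show "\<Gamma> x a (\<Gamma> v a y b u) b z = \<Gamma> (\<Gamma> x a u b y) a v b z"
      using Gamma_assoc_outer[OF ab] by simp
    show "prod_ab b a x y z = opposite (prod_ab a b) x y z"
      unfolding prod_ab_def opposite_def by (rule Gamma_reverse)
  \<comment> \<open>These are the conjuncts on closure, extension, the Klein symmetries and the
    semitorsor properties. \<open>erule (4)\<close> discharges all five membership premises.\<close>
  qed (rule Gamma_reverse | erule (4) Gamma_in_Gras | erule (4) Gamma_swap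
      | erule Gamma_extends_Gamma0 | erule (1) semitorsor_prod_ab
      | erule commutative_semitorsor_prod_aa)+
qed

end
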